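(* Let $(X,\mathcal{T}_1,\mathcal{T}_2,E)$ be a bi-soft topological space over $X$. If $(X,\mathcal{T}_1,\mathcal{T}_2,E)$ is a pair-wise soft $T_1$-space, then $(X,\mathcal{T}_1\vee\mathcal{T}_2,E)$ is also a soft $T_1$-space.
   Context: $X$ is a set (initial universe) and $E$ is a non-empty set of parameters. A soft set $(F,E)$ over $X$ is a map $F:E\to\mathcal{P}(X)$, where $\mathcal{P}(X)$ is the power set of $X$. Unions and intersections of soft sets are taken parameterwise. $\Phi$ denotes the soft set with value $\emptyset$ at every $e\in E$ and $\widetilde{X}$ the soft set with value $X$ at every $e\in E$. For $x\in X$, $x\in(F,E)$ means $x\in F(e)$ for all $e\in E$ (so $x\notin(F,E)$ means $x\notin F(e)$ for some $e\in E$). A soft topology on $X$ is a collection $\mathcal{T}$ of soft sets over $X$ (with parameter set $E$) containing $\Phi$ and $\widetilde{X}$ and closed under arbitrary unions and under intersections of two members; $(X,\mathcal{T},E)$ is then a soft topological space and members of $\mathcal{T}$ are called soft open. A bi-soft topological space $(X,\mathcal{T}_1,\mathcal{T}_2,E)$ consists of two soft topologies $\mathcal{T}_1,\mathcal{T}_2$ on $X$ with the same parameter set $E$. $\mathcal{T}_1\vee\mathcal{T}_2$ denotes the smallest soft topology on $X$ containing $\mathcal{T}_1\cup\mathcal{T}_2$. $(X,\mathcal{T},E)$ is a soft $T_1$-space if for all $x,y\in X$ with $x\neq y$ there are soft open sets $(F,E),(G,E)\in\mathcal{T}$ with $x\in(F,E)$, $y\notin(F,E)$ and $y\in(G,E)$,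 $x\notin(G,E)$. $(X,\mathcal{T}_1,\mathcal{T}_2,E)$ is a pair-wise soft $T_1$-space if for all $x,y\in X$ with $x\neq y$ there are $(F,E)\in\mathcal{T}_1$ with $x\in(F,E)$, $y\notin(F,E)$ and $(G,E)\in\mathcal{T}_2$ with $x\notin(G,E)$, $y\in(G,E)$. *)

theory Defs
  imports Main "HOL-Library.FuncSet"
begin

(* Soft sets are extensional functions on E, so that two soft sets over X are equal
   exactly when they agree at every parameter in E. *)
definition soft_sets :: "'a set \<Rightarrow> 'e set \<Rightarrow> ('e \<Rightarrow> 'a set) set" where
  "soft_sets X E = E \<rightarrow>\<^sub>E Pow X"

definition soft_null :: "'e set \<Rightarrow> 'e \<Rightarrow> 'a set" where
  "soft_null E = (\<lambda>e\<in>E. {})"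

definition soft_abs :: "'a set \<Rightarrow> 'e set \<Rightarrow> 'e \<Rightarrow> 'a set" where
  "soft_abs X E = (\<lambda>e\<in>E. X)"

definition soft_Union :: "'e set \<Rightarrow> ('e \<Rightarrow> 'a set) set \<Rightarrow> 'e \<Rightarrow> 'a set" where
  "soft_Union E S = (\<lambda>e\<in>E. \<Union>F\<in>S. F e)"

definition soft_inter :: "'e set \<Rightarrow> ('e \<Rightarrow> 'a set) \<Rightarrow> ('e \<Rightarrow> 'a set) \<Rightarrow> 'e \<Rightarrow> 'a set" where
  "soft_inter E F G = (\<lambda>e\<in>E. F e \<inter> G e)"

(* The negation only says that x is missing from F e for some parameter e. *)
definition soft_mem :: "'e set \<Rightarrow> 'a \<Rightarrow> ('e \<Rightarrow> 'a set) \<Rightarrow> bool" where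
  "soft_mem E x F \<longleftrightarrow> (\<forall>e\<in>E. x \<in> F e)"

definition soft_topology :: "'a set \<Rightarrow> 'e set \<Rightarrow> ('e \<Rightarrow> 'a set) set \<Rightarrow> bool" where
  "soft_topology X E T \<longleftrightarrow>
     T \<subseteq> soft_sets X E \<and>
     soft_null E \<in> T \<and>
     soft_abs X E \<in> T \<and>
     (\<forall>S. S \<subseteq> T \<longrightarrow> soft_Union E S \<in> T) \<and>
     (\<forall>F\<in>T. \<forall>G\<in>T. soft_inter E F G \<in> T)"

definition soft_topological_space :: "'a set \<Rightarrow> ('e \<Rightarrow> 'a set) set \<Rightarrow> 'e set \<Rightarrow> bool" where
  "soft_topological_space X T E \<longleftrightarrow> E \<noteq> {} \<and> soft_topology X E T"

definition bi_soft_topological_space ::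
    "'a set \<Rightarrow> ('e \<Rightarrow> 'a set) set \<Rightarrow> ('e \<Rightarrow> 'a set) set \<Rightarrow> 'e set \<Rightarrow> bool" where
  "bi_soft_topological_space X T1 T2 E \<longleftrightarrow>
     E \<noteq> {} \<and> soft_topology X E T1 \<and> soft_topology X E T2"

definition soft_join ::
    "'a set \<Rightarrow> 'e set \<Rightarrow> ('e \<Rightarrow> 'a set) set \<Rightarrow> ('e \<Rightarrow> 'a set) set \<Rightarrow> ('e \<Rightarrow> 'a set) set" where
  "soft_join X E T1 T2 = (LEAST T. soft_topology X E T \<and> T1 \<union> T2 \<subseteq> T)"

definition soft_T1_space :: "'a set \<Rightarrow> ('e \<Rightarrow> 'a set) set \<Rightarrow> 'e set \<Rightarrow> bool" where
  "soft_T1_space X T E \<longleftrightarrow>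
     soft_topological_space X T E \<and>
     (\<forall>x\<in>X. \<forall>y\<in>X. x \<noteq> y \<longrightarrow>
        (\<exists>F\<in>T. \<exists>G\<in>T. soft_mem E x F \<and> \<not> soft_mem E y F \<and>
                       soft_mem E y G \<and> \<not> soft_mem E x G))"

definition pairwise_soft_T1_space ::
    "'a set \<Rightarrow> ('e \<Rightarrow> 'a set) set \<Rightarrow> ('e \<Rightarrow> 'a set) set \<Rightarrow> 'e set \<Rightarrow> bool" where
  "pairwise_soft_T1_space X T1 T2 E \<longleftrightarrow>
     bi_soft_topological_space X T1 T2 E \<and>
     (\<forall>x\<in>X. \<forall>y\<in>X. x \<noteq> y \<longrightarrow>
        (\<exists>F\<in>T1. soft_mem E x F \<and> \<not> soft_mem E y F) \<and>
        (\<exists>G\<in>T2. \<not> soft_mem E x G \<and> soft_mem E y G))"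

(* The smallest soft topology exists, so the LEAST in soft_join is meaningful. *)
lemma soft_topology_soft_sets: "soft_topology X E (soft_sets X E)"
  unfolding soft_topology_def soft_sets_def soft_null_def soft_abs_def
    soft_Union_def soft_inter_def
  by (auto simp: PiE_iff)

lemma soft_topology_Inter:
  assumes "\<T> \<noteq> {}" and "\<And>T. T \<in> \<T> \<Longrightarrow> soft_topology X E T"
  shows "soft_topology X E (\<Inter>\<T>)"
  using assms unfolding soft_topology_def by (auto simp: le_Inf_iff Inf_less_eq)

lemma soft_join_eq_Inter:
  assumes "T1 \<subseteq> soft_sets X E" and "T2 \<subseteq> soft_sets X E"
  shows "soft_join X E T1 T2 = \<Inter>{T. soft_topology X E T \<and> T1 \<union> T2 \<subseteq> T}"
  unfolding soft_join_def
proof (rule Least_equality)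
  let ?C = "{T. soft_topology X E T \<and> T1 \<union> T2 \<subseteq> T}"
  have "soft_sets X E \<in> ?C"
    using assms soft_topology_soft_sets by auto
  then have "soft_topology X E (\<Inter>?C)"
    by (intro soft_topology_Inter) auto
  then show "soft_topology X E (\<Inter>?C) \<and> T1 \<union> T2 \<subseteq> \<Inter>?C"
    by blast
qed blast

end

theory Submission
  imports Defs
begin

text \<open>The join contains both topologies, so the two sets that separate a pair of points
  pairwise, one from each topology, are both open in the join. What has to be checked is that the
  join really is a soft topology above both: it is the intersection of all such topologies, and
  there is at least one, since the collection of all soft sets is a soft topology.\<close>

lemma soft_topology_soft_join:
  assumes "T1 \<subseteq> soft_sets X E" and "T2 \<subseteq> soft_sets X E"
  shows "soft_topology X E (soft_join X E T1 T2)"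
  unfolding soft_join_eq_Inter[OF assms]
proof (rule soft_topology_Inter)
  \<comment> \<open>The discrete soft topology makes the intersected family nonempty.\<close>
  have "soft_sets X E \<in> {T. soft_topology X E T \<and> T1 \<union> T2 \<subseteq> T}"
    using assms soft_topology_soft_sets by simp
  then show "{T. soft_topology X E T \<and> T1 \<union> T2 \<subseteq> T} \<noteq> {}"
    by blast
qed simp

lemma soft_join_upper:
  assumes "T1 \<subseteq> soft_sets X E" and "T2 \<subseteq> soft_sets X E"
  shows "T1 \<union> T2 \<subseteq> soft_join X E T1 T2"
  unfolding soft_join_eq_Inter[OF assms] by blast

theorem proposition8:
  fixes X :: "'a set" and E :: "'e set" and T1 T2 :: "('e \<Rightarrow> 'a set) set"
  assumes "bi_soft_topological_space X T1 T2 E"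
    and "pairwise_soft_T1_space X T1 T2 E"
  shows "soft_T1_space X (soft_join X E T1 T2) E"
proof -
  have "E \<noteq> {}" and sub: "T1 \<subseteq> soft_sets X E" "T2 \<subseteq> soft_sets X E"
    using assms(1) by (auto simp: bi_soft_topological_space_def soft_topology_def)
  then have "soft_topological_space X (soft_join X E T1 T2) E"
    by (simp add: soft_topological_space_def soft_topology_soft_join)
  moreover have "\<exists>F\<in>soft_join X E T1 T2. \<exists>G\<in>soft_join X E T1 T2.
      soft_mem E x F \<and> \<not> soft_mem E y F \<and> soft_mem E y G \<and> \<not> soft_mem E x G"
    if xy: "x \<in> X" "y \<in> X" "x \<noteq> y" for x y
  proof -
    obtain F G where "F \<in> T1" "soft_mem E x F" "\<not> soft_mem E y F"
      and "G \<in> T2" "\<not> soft_mem E x G" "soft_mem E y G"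
      using assms(2) xy unfolding pairwise_soft_T1_space_def by blast
    with soft_join_upper[OF sub] show ?thesis by blast
  qed
  ultimately show ?thesis
    unfolding soft_T1_space_def by blast
qed

end
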